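(* Let $n\ge 1$ and let $u:\mathbb{R}^n\to\mathbb{R}$ be a non-constant solution of the Allen-Cahn equation $-\Delta u=u-u^3$ in $\mathbb{R}^n$. Then there does not exist a non-degenerate cone containing the zero level set $\{u=0\}=\{x\in\mathbb{R}^n:u(x)=0\}$.
   Context: Solutions are real-valued and understood in the classical sense on all of $\mathbb{R}^n$. A non-degenerate cone is a subset of $\mathbb{R}^n$ which, up to translation and rotation of the variables, is of the form $\{(x',x_n)\in\mathbb{R}^{n-1}\times\mathbb{R}: x_n\ge\beta|x'|\}$ for some $\beta>0$, where $|\cdot|$ is the Euclidean norm.
   Formalization: The formal theorem assumes n ≥ 2 instead of n ≥ 1; for n = 1 the claim is false, since the cone is the half-line [0,∞) and the non-constant solution tanh(x/√2) has zero set {0} inside it. *)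

theory Defs
  imports "HOL-Analysis.Analysis"
begin

text \<open>
  \<open>frechet_derivative\<close> is unspecified at points of non-differentiability; all uses below come
  with differentiability, which is part of \<open>C1\<close>.
\<close>

definition partial_deriv :: "'n \<Rightarrow> (real^'n \<Rightarrow> real) \<Rightarrow> real^'n \<Rightarrow> real" where
  "partial_deriv i f x = frechet_derivative f (at x) (axis i 1)"

definition C1 :: "(real^'n \<Rightarrow> real) \<Rightarrow> bool" where
  "C1 f \<longleftrightarrow> (\<forall>x. f differentiable (at x)) \<and> (\<forall>i. continuous_on UNIV (partial_deriv i f))"

definition C2 :: "(real^'n \<Rightarrow> real) \<Rightarrow> bool" where
  "C2 f \<longleftrightarrow> C1 f \<and> (\<forall>i. C1 (partial_deriv i f))"

definition laplacian :: "(real^'n \<Rightarrow> real) \<Rightarrow> real^'n \<Rightarrow> real" where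
  "laplacian f x = (\<Sum>i\<in>UNIV. partial_deriv i (partial_deriv i f) x)"

definition allen_cahn_solution :: "(real^'n \<Rightarrow> real) \<Rightarrow> bool" where
  "allen_cahn_solution u \<longleftrightarrow> C2 u \<and> (\<forall>x. - laplacian u x = u x - u x ^ 3)"

text \<open>
  The finite index type carries no order, so the cone
  \<open>{(x', x\<^sub>n). x\<^sub>n \<ge> \<beta> * norm x'}\<close> is taken along an arbitrary coordinate \<open>k\<close> in
  place of the last one; \<open>x'\<close> is represented by \<open>x\<close> with its \<open>k\<close>-th coordinate set to 0,
  which has the same Euclidean norm.
\<close>

definition standard_cone :: "'n \<Rightarrow> real \<Rightarrow> (real^'n) set" where
  "standard_cone k \<beta> = {x. x $ k \<ge> \<beta> * norm (\<chi> i. if i = k then 0 else x $ i)}"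

text \<open>
  In dimension 1 the parameter \<open>\<beta>\<close> plays no role: the standard cone is the closed half-line
  \<open>x \<ge> 0\<close>, and it contains the zero set \<open>{0}\<close> of the non-constant solution
  \<open>tanh (x / sqrt 2)\<close>. A nonexistence statement about these cones therefore needs
  dimension at least 2.

  In dimension at least 2, the choice of \<open>k\<close> does not matter: any two coordinate axes are
  exchanged by a rotation that maps the corresponding standard cones onto each other.
\<close>

definition nondegenerate_cone :: "(real^'n) set \<Rightarrow> bool" where
  "nondegenerate_cone S \<longleftrightarrow>
     (\<exists>k \<beta> Q a. \<beta> > 0 \<and> rotation_matrix Q \<and> S = (\<lambda>x. a + Q *v x) ` standard_cone k \<beta>)"

end

theory Submission
  imports Defs
begin

text \<open>
  Let \<open>e\<close> be the axis and \<open>a\<close> the vertex of a cone containing the zero set. The complement of the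
  cone is connected, so \<open>u\<close> has a sign there, say positive. Barriers on large balls give
  \<open>\<bar>u\<bar> \<le> 1\<close> everywhere (Keller--Osserman) and \<open>u \<ge> 3/4\<close> far from the cone. In every half-space
  \<open>e \<bullet> (x - a) \<le> R\<close> the cone is bounded, so there \<open>u \<ge> 3/4\<close> outside a ball. Hence the
  one-dimensional solutions \<open>tanh ((\<tau> - e \<bullet> (x - a)) / sqrt 2)\<close> can be slid below \<open>u\<close> with
  \<open>\<tau>\<close> increasing without bound: contact at infinity is excluded because \<open>s - s^3\<close> is decreasing
  near \<open>1\<close> and \<open>-1\<close>, and contact at a point by the strong maximum principle, since the zero set of
  the translate is an unbounded hyperplane. In the limit \<open>u \<ge> 1\<close>, so \<open>u\<close> is constant.
\<close>

section \<open>Pointwise Laplacians: linearity, chain rule and the basic functions\<close>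

text \<open>
  \<open>D\<close> is the gradient of \<open>g\<close> near \<open>x\<close>, and \<open>L\<close> its Laplacian at the single point \<open>x\<close>. Only
  derivatives along coordinate lines are required, which suffices for the second-derivative test
  and makes the notion local, so that barriers blowing up on a sphere are covered.
\<close>

definition lap_at :: "(real^'n \<Rightarrow> real) \<Rightarrow> (real^'n \<Rightarrow> real^'n) \<Rightarrow> real \<Rightarrow> real^'n \<Rightarrow> bool" where
  "lap_at g D L x \<longleftrightarrow>
     (\<forall>\<^sub>F y in nhds x. \<forall>i. ((\<lambda>t. g (y + t *\<^sub>R axis i 1)) has_real_derivative D y $ i) (at 0)) \<and>
     (\<exists>H. (\<forall>i. ((\<lambda>t. D (x + t *\<^sub>R axis i 1) $ i) has_real_derivative H i) (at 0)) \<and>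
          L = (\<Sum>i\<in>UNIV. H i))"

lemma lap_at_lin:
  assumes "lap_at g D L x" "lap_at h E K x"
  shows "lap_at (\<lambda>x. g x + c * h x) (\<lambda>x. D x + c *\<^sub>R E x) (L + c * K) x"
proof -
  from assms obtain H1 H2 where
    1: "\<forall>\<^sub>F y in nhds x. \<forall>i. ((\<lambda>t. g (y + t *\<^sub>R axis i 1)) has_real_derivative D y $ i) (at 0)"
       "\<forall>\<^sub>F y in nhds x. \<forall>i. ((\<lambda>t. h (y + t *\<^sub>R axis i 1)) has_real_derivative E y $ i) (at 0)"
    and 2: "\<And>i. ((\<lambda>t. D (x + t *\<^sub>R axis i 1) $ i) has_real_derivative H1 i) (at 0)"
       "\<And>i. ((\<lambda>t. E (x + t *\<^sub>R axis i 1) $ i) has_real_derivative H2 i) (at 0)"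
    and 3: "L = (\<Sum>i\<in>UNIV. H1 i)" "K = (\<Sum>i\<in>UNIV. H2 i)"
    unfolding lap_at_def by blast
  show ?thesis unfolding lap_at_def
  proof (intro conjI exI allI)
    show "\<forall>\<^sub>F y in nhds x. \<forall>i. ((\<lambda>t. g (y + t *\<^sub>R axis i 1) + c * h (y + t *\<^sub>R axis i 1))
        has_real_derivative (D y + c *\<^sub>R E y) $ i) (at 0)"
      using 1 by eventually_elim (auto intro!: derivative_eq_intros)
    show "((\<lambda>t. (D (x + t *\<^sub>R axis i 1) + c *\<^sub>R E (x + t *\<^sub>R axis i 1)) $ i)
        has_real_derivative H1 i + c * H2 i) (at 0)" for i
      using 2[of i] by (auto intro!: derivative_eq_intros)
    show "L + c * K = (\<Sum>i\<in>UNIV. H1 i + c * H2 i)"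
      by (simp add: 3 sum.distrib sum_distrib_left)
  qed
qed

text \<open>Every barrier is a profile of the squared distance, and the travelling solutions are
  profiles of a linear function. \<open>F\<close> is differentiated only at values that
  \<open>g\<close> takes near \<open>x\<close>, so a profile with a pole elsewhere is
  allowed.\<close>

lemma lap_at_chain:
  assumes g: "lap_at g D L x"
    and F: "\<forall>\<^sub>F y in nhds x. (F has_real_derivative F' (g y)) (at (g y))"
    and F': "(F' has_real_derivative F'') (at (g x))"
  shows "lap_at (\<lambda>x. F (g x)) (\<lambda>x. F' (g x) *\<^sub>R D x) (F'' * (D x \<bullet> D x) + F' (g x) * L) x"
proof -
  from g obtain H where
    1: "\<forall>\<^sub>F y in nhds x. \<forall>i. ((\<lambda>t. g (y + t *\<^sub>R axis i 1)) has_real_derivative D y $ i) (at 0)"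
    and 2: "\<And>i. ((\<lambda>t. D (x + t *\<^sub>R axis i 1) $ i) has_real_derivative H i) (at 0)"
    and 3: "L = (\<Sum>i\<in>UNIV. H i)"
    unfolding lap_at_def by blast
  have g1: "((\<lambda>t. g (x + t *\<^sub>R axis i 1)) has_real_derivative D x $ i) (at 0)" for i
    using eventually_nhds_x_imp_x[OF 1] by blast
  show ?thesis unfolding lap_at_def
  proof (intro conjI exI allI)
    show "\<forall>\<^sub>F y in nhds x. \<forall>i. ((\<lambda>t. F (g (y + t *\<^sub>R axis i 1)))
        has_real_derivative (F' (g y) *\<^sub>R D y) $ i) (at 0)"
      using 1 F
    proof eventually_elim
      case (elim y)
      show ?case
      proof
        fix i
        have "(F has_real_derivative F' (g y)) (at (g (y + 0 *\<^sub>R axis i 1)))"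
          using elim by simp
        from DERIV_chain2[OF this elim(1)[rule_format, of i]]
        show "((\<lambda>t. F (g (y + t *\<^sub>R axis i 1))) has_real_derivative (F' (g y) *\<^sub>R D y) $ i) (at 0)"
          by simp
      qed
    qed
    show "((\<lambda>t. (F' (g (x + t *\<^sub>R axis i 1)) *\<^sub>R D (x + t *\<^sub>R axis i 1)) $ i)
        has_real_derivative F'' * (D x $ i)^2 + F' (g x) * H i) (at 0)" for i
    proof -
      have "(F' has_real_derivative F'') (at (g (x + 0 *\<^sub>R axis i 1)))"
        using F' by simp
      from DERIV_mult[OF DERIV_chain2[OF this g1[of i]] 2[of i]]
      show ?thesis by (simp add: power2_eq_square algebra_simps)
    qed
    show "F'' * (D x \<bullet> D x) + F' (g x) * L = (\<Sum>i\<in>UNIV. F'' * (D x $ i)^2 + F' (g x) * H i)"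
      by (simp add: 3 sum.distrib sum_distrib_left inner_vec_def power2_eq_square)
  qed
qed

lemma lap_at_dist_sq:
  "lap_at (\<lambda>x. (dist x y)^2) (\<lambda>x. 2 *\<^sub>R (x - y)) (2 * real CARD('n)) (x::real^'n)"
  unfolding lap_at_def
proof (intro conjI exI allI always_eventually)
  fix z :: "real^'n" and i
  have eq: "(dist (z + t *\<^sub>R axis i 1) y)^2 = (dist z y)^2 + 2 * t * (z - y) $ i + t^2" for t
  proof -
    have "z + t *\<^sub>R axis i 1 - y = (z - y) + t *\<^sub>R axis i 1" by simp
    then show ?thesis
      unfolding dist_norm power2_norm_eq_inner
      by (simp only: inner_add_left inner_add_right inner_scaleR_left inner_scaleR_right)
         (simp add: inner_axis inner_axis' power2_eq_square distrib_left)
  qed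
  show "((\<lambda>t. (dist (z + t *\<^sub>R axis i 1) y)^2) has_real_derivative (2 *\<^sub>R (z - y)) $ i) (at 0)"
    unfolding eq by (auto intro!: derivative_eq_intros)
next
  fix i
  show "((\<lambda>t. (2 *\<^sub>R (x + t *\<^sub>R axis i 1 - y)) $ i) has_real_derivative 2) (at 0)"
    by (auto intro!: derivative_eq_intros)
qed auto

text \<open>Working with the squared distance instead of the distance keeps the centre
  \<open>y\<close> from being singular. The gradient stays existential because the comparisons use
  only the Laplacian.\<close>

lemma lap_at_radial:
  fixes x y :: "real^'n"
  assumes "\<forall>\<^sub>F z in nhds x. (F has_real_derivative F' ((dist z y)^2)) (at ((dist z y)^2))"
    and "(F' has_real_derivative F'') (at ((dist x y)^2))"
  shows "\<exists>D. lap_at (\<lambda>x. F ((dist x y)^2)) D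
    (4 * F'' * (dist x y)^2 + 2 * real CARD('n) * F' ((dist x y)^2)) x"
proof -
  have "(2 *\<^sub>R (x - y)) \<bullet> (2 *\<^sub>R (x - y)) = 4 * (dist x y)^2"
    by (simp add: dist_norm power2_norm_eq_inner)
  then have "F'' * ((2 *\<^sub>R (x - y)) \<bullet> (2 *\<^sub>R (x - y))) + F' ((dist x y)^2) * (2 * real CARD('n))
      = 4 * F'' * (dist x y)^2 + 2 * real CARD('n) * F' ((dist x y)^2)"
    by simp
  with lap_at_chain[OF lap_at_dist_sq[of y x] assms] show ?thesis by metis
qed

lemma lap_at_inner:
  "lap_at (\<lambda>x. e \<bullet> (x - a)) (\<lambda>_. e) 0 (x::real^'n)"
  unfolding lap_at_def
proof (intro conjI exI allI always_eventually)
  fix z :: "real^'n" and i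
  show "((\<lambda>t. e \<bullet> (z + t *\<^sub>R axis i 1 - a)) has_real_derivative e $ i) (at 0)"
    by (auto intro!: derivative_eq_intros simp: inner_add_right inner_diff_right inner_axis)
  show "((\<lambda>t. e $ i) has_real_derivative 0) (at 0)" by simp
qed simp

lemma C1_line_derivative:
  assumes "C1 f"
  shows "((\<lambda>t. f (y + t *\<^sub>R axis i 1)) has_real_derivative partial_deriv i f y) (at 0)"
proof -
  have "(f has_derivative frechet_derivative f (at y)) (at (y + 0 *\<^sub>R axis i 1))"
    using assms frechet_derivative_works unfolding C1_def by fastforce
  moreover have "((\<lambda>t. y + t *\<^sub>R axis i 1) has_derivative (\<lambda>t. t *\<^sub>R axis i 1)) (at 0)"
    by (auto intro!: derivative_eq_intros)
  ultimately have "((\<lambda>t. f (y + t *\<^sub>R axis i 1)) has_derivative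
      (\<lambda>t. frechet_derivative f (at y) (t *\<^sub>R axis i 1))) (at 0)"
    using has_derivative_compose by blast
  moreover have "linear (frechet_derivative f (at y))"
    using assms linear_frechet_derivative unfolding C1_def by blast
  ultimately show ?thesis
    by (simp add: has_field_derivative_def partial_deriv_def linear_cmul mult.commute[of _ "frechet_derivative f (at y) (axis i 1)"])
qed

lemma lap_at_C2:
  assumes "C2 f"
  shows "lap_at f (\<lambda>y. \<chi> i. partial_deriv i f y) (laplacian f x) x"
  using assms unfolding lap_at_def C2_def laplacian_def
  by (auto intro!: exI[of _ "\<lambda>i. partial_deriv i (partial_deriv i f) x"] always_eventually C1_line_derivative)

section \<open>Touching from below and maximum principles\<close>

text \<open>Second-derivative test on each coordinate line: the first derivative vanishes at the
  minimum, so a negative second derivative would make it negative just after, and by the mean value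
  theorem \<open>g\<close> would drop below \<open>g x\<close>.\<close>

lemma lap_at_min:
  assumes g: "lap_at g D L x" and mn: "\<forall>\<^sub>F y in nhds x. g x \<le> g y"
  shows "0 \<le> L"
proof -
  from g obtain H where
    1: "\<forall>\<^sub>F y in nhds x. \<forall>i. ((\<lambda>t. g (y + t *\<^sub>R axis i 1)) has_real_derivative D y $ i) (at 0)"
    and 2: "\<And>i. ((\<lambda>t. D (x + t *\<^sub>R axis i 1) $ i) has_real_derivative H i) (at 0)"
    and 3: "L = (\<Sum>i\<in>UNIV. H i)"
    unfolding lap_at_def by blast
  from eventually_conj[OF 1 mn] obtain d where d: "d > 0"
    and dd: "\<And>y. dist y x < d \<Longrightarrow> (\<forall>i. ((\<lambda>t. g (y + t *\<^sub>R axis i 1)) has_real_derivative D y $ i) (at 0))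
      \<and> g x \<le> g y"
    unfolding eventually_nhds_metric by blast
  have "0 \<le> H i" for i
  proof (rule ccontr)
    assume neg: "\<not> 0 \<le> H i"
    define p where "p = (\<lambda>t. g (x + t *\<^sub>R axis i 1))"
    define q where "q = (\<lambda>t. D (x + t *\<^sub>R axis i 1) $ i)"
    have dist: "dist (x + t *\<^sub>R axis i 1) x = \<bar>t\<bar>" for t
      by (simp add: dist_norm)
    have p': "(p has_real_derivative q t) (at t)" if "\<bar>t\<bar> < d" for t
    proof -
      have "((\<lambda>h. p (h + t)) has_real_derivative q t) (at 0)"
        using dd[of "x + t *\<^sub>R axis i 1"] that
        by (simp add: dist p_def q_def scaleR_add_left add.commute add.left_commute)
      then show ?thesis using DERIV_shift[of p "q t" 0 t] by simp
    qed
    have pmin: "p 0 \<le> p t" if "\<bar>t\<bar> < d" for t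
      using dd[of "x + t *\<^sub>R axis i 1"] that by (simp add: dist p_def)
    have "q 0 = 0"
      using DERIV_local_min[OF p'[of 0] d] d pmin by simp
    moreover have "(q has_real_derivative H i) (at 0)"
      using 2 by (simp add: q_def)
    then obtain d' where d': "d' > 0" "\<And>h. 0 < h \<Longrightarrow> h < d' \<Longrightarrow> q (0 + h) < q 0"
      using DERIV_neg_dec_right[of q "H i" 0] neg by force
    ultimately have qneg: "q h < 0" if "0 < h" "h < d'" for h using that by force
    define h where "h = min d d' / 2"
    have h: "0 < h" "h < d" "h < d'" using d d'(1) by (auto simp: h_def)
    obtain c where "0 < c" "c < h" "p h - p 0 = (h - 0) * q c"
      using MVT2[of 0 h p q] p' h by force
    then have "p h < p 0" using qneg[of c] h mult_pos_neg[of h "q c"] by simp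
    then show False using pmin[of h] h by simp
  qed
  then show ?thesis by (simp add: 3 sum_nonneg)
qed

text \<open>The form in which barriers are used: up to an additive constant, \<open>v\<close>
  touches \<open>u\<close> from below at \<open>x\<close>.\<close>

lemma lap_at_touching:
  assumes u: "lap_at u D L x" and v: "lap_at v E K x"
    and "\<forall>\<^sub>F y in nhds x. u x - v x \<le> u y - v y"
  shows "K \<le> L"
proof -
  have "0 \<le> L + (-1) * K"
    by (rule lap_at_min[OF lap_at_lin[OF u v]]) (use assms in simp)
  then show ?thesis by simp
qed

text \<open>Values on the sphere lie below the value at the centre, so the maximum over the compact
  ball is interior and hence a local maximum.\<close>

lemma exists_max_cball:
  fixes g :: "'a::euclidean_space \<Rightarrow> real"
  assumes "continuous_on (cball y R) g" "0 < R" "\<And>x. dist x y = R \<Longrightarrow> g x < g y"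
  obtains x where "dist x y < R" "g y \<le> g x" "\<forall>\<^sub>F z in nhds x. g z \<le> g x"
    "\<And>z. dist z y \<le> R \<Longrightarrow> g z \<le> g x"
proof -
  obtain x where x: "x \<in> cball y R" "\<And>z. z \<in> cball y R \<Longrightarrow> g z \<le> g x"
    using continuous_attains_sup[of "cball y R" g] assms by fastforce
  have gy: "g y \<le> g x" using x(2)[of y] assms by simp
  have d: "dist x y < R" using assms(3)[of x] gy x(1) by (force simp: dist_commute)
  have "\<forall>\<^sub>F z in nhds x. z \<in> ball y R"
    using d by (intro eventually_nhds_in_open) (auto simp: dist_commute)
  then have "\<forall>\<^sub>F z in nhds x. g z \<le> g x"
    by eventually_elim (simp add: x(2))
  with that[OF d gy] x(2) show thesis by (simp add: dist_commute)
qed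

text \<open>The penalty \<open>- \<epsilon> * (dist x p)\<^sup>2\<close> forces the maximum to be attained, at a Laplacian cost of \<open>2 * n * \<epsilon>\<close>.\<close>

lemma max_principle:
  fixes z :: "real^'n \<Rightarrow> real"
  assumes cont: "continuous_on UNIV z" and bdd: "\<And>x. z x \<le> B" and c: "0 < c"
    and lap: "\<And>x. 0 < z x \<Longrightarrow> \<exists>D L. lap_at z D L x \<and> c * z x \<le> L"
  shows "z p \<le> 0"
proof (rule ccontr)
  assume "\<not> z p \<le> 0"
  then have zp: "0 < z p" by simp
  define n where "n = real CARD('n)"
  have n: "0 < n" by (simp add: n_def)
  \<comment> \<open>Makes the penalty's Laplacian \<open>2 * n * \<epsilon>\<close> equal to half of
    \<open>c * z p\<close>.\<close>
  define \<epsilon> where "\<epsilon> = c * z p / (4 * n)"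
  have \<epsilon>: "0 < \<epsilon>" using c zp n by (simp add: \<epsilon>_def)
  \<comment> \<open>On this sphere the penalty is \<open>\<bar>B\<bar> + 1\<close>, which makes
    \<open>g\<close> negative there, while \<open>g p = z p\<close> is positive.\<close>
  define R where "R = sqrt ((\<bar>B\<bar> + 1) / \<epsilon>)"
  have R: "0 < R" using \<epsilon> by (simp add: R_def add_nonneg_pos)
  have R2: "\<epsilon> * R^2 = \<bar>B\<bar> + 1" using \<epsilon> by (simp add: R_def)
  define g where "g = (\<lambda>x. z x + (-\<epsilon>) * (dist x p)^2)"
  have "continuous_on (cball p R) g" unfolding g_def
    by (intro continuous_intros continuous_on_subset[OF cont]) auto
  moreover have "g x < g p" if "dist x p = R" for x
    using bdd[of x] R2 zp that by (simp add: g_def)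
  ultimately obtain x where x: "g p \<le> g x" "\<forall>\<^sub>F y in nhds x. g y \<le> g x"
    using exists_max_cball[of p R g] R by metis
  have zx: "z p \<le> z x" using x(1) \<epsilon> by (simp add: g_def) (smt (verit) mult_nonneg_nonneg zero_le_power2)
  obtain D L where L: "lap_at z D L x" "c * z x \<le> L" using lap[of x] zx zp by fastforce
  \<comment> \<open>The zero summand, a linear function with \<open>e = 0\<close>, lets
    \<open>lap_at_lin\<close> produce a plain scalar multiple.\<close>
  have sq: "lap_at (\<lambda>x. 0 + \<epsilon> * (dist x p)^2) (\<lambda>x. 0 + \<epsilon> *\<^sub>R (2 *\<^sub>R (x - p))) (0 + \<epsilon> * (2 * n)) x"
    unfolding n_def using lap_at_lin[OF lap_at_inner[of 0 0 x] lap_at_dist_sq[of p x], of \<epsilon>]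
    by simp
  have "L \<le> 0 + \<epsilon> * (2 * n)"
    by (rule lap_at_touching[OF sq L(1)]) (use x(2) in \<open>simp add: g_def algebra_simps\<close>)
  also have "\<dots> = c * z p / 2" using n by (simp add: \<epsilon>_def)
  also have "\<dots> < c * z p" using c zp by simp
  also have "\<dots> \<le> c * z x" using zx c by simp
  finally show False using L(2) by simp
qed

text \<open>Barrier: a multiple of \<open>exp (- \<alpha> * r\<^sup>2) - exp (- \<alpha> * R\<^sup>2)\<close>, centred at \<open>p\<close>, with \<open>\<alpha>\<close> large.\<close>

lemma strong_max_principle:
  fixes z :: "real^'n \<Rightarrow> real"
  assumes cont: "continuous_on UNIV z" and nonneg: "\<And>x. 0 \<le> z x"
    and lap: "\<And>x. \<exists>D L. lap_at z D L x \<and> L \<le> M * z x" and p: "0 < z p"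
  shows "0 < z q"
proof (rule ccontr)
  assume "\<not> 0 < z q"
  then have zq: "z q = 0" using nonneg[of q] by simp
  define n where "n = real CARD('n)"
  have n: "0 < n" by (simp add: n_def)
  have "(z \<longlongrightarrow> z p) (nhds p)"
    using cont by (simp add: continuous_on_eq_continuous_at isCont_def tendsto_at_iff_tendsto_nhds)
  then have "\<forall>\<^sub>F x in nhds p. z p / 2 < z x"
    by (rule order_tendstoD) (use p in simp)
  then obtain r where r: "0 < r" "\<And>x. dist x p < r \<Longrightarrow> z p / 2 < z x"
    unfolding eventually_nhds_metric by blast
  define m where "m = z p / 2"
  have m: "0 < m" using p by (simp add: m_def)
  \<comment> \<open>The fraction makes the barrier's Laplacian at least
    \<open>\<bar>M\<bar> + 1\<close> times its exponential part at distance \<open>r\<close> or more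
    from \<open>p\<close>; the extra 1 gives \<open>\<alpha> \<ge> 1\<close>.\<close>
  define \<alpha> where "\<alpha> = (2 * n + \<bar>M\<bar> + 1) / (4 * r^2) + 1"
  have \<alpha>: "1 \<le> \<alpha>" using n by (simp add: \<alpha>_def)
  have \<alpha>r: "\<bar>M\<bar> + 1 \<le> 4 * \<alpha>^2 * r^2 - 2 * n * \<alpha>"
  proof -
    have "2 * n + \<bar>M\<bar> + 1 \<le> 4 * r^2 * \<alpha>" using r(1) by (simp add: \<alpha>_def field_simps)
    then have "\<alpha> * (2 * n + \<bar>M\<bar> + 1) \<le> \<alpha> * (4 * r^2 * \<alpha>)" using \<alpha> by (intro mult_left_mono) auto
    moreover have "1 * (\<bar>M\<bar> + 1) \<le> \<alpha> * (\<bar>M\<bar> + 1)" using \<alpha> by (intro mult_right_mono) auto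
    ultimately show ?thesis by (simp add: algebra_simps power2_eq_square)
  qed
  \<comment> \<open>The extra 1 puts \<open>q\<close> strictly inside the ball, where the barrier is
    positive although \<open>z q = 0\<close>.\<close>
  define R where "R = dist q p + 1"
  have R: "0 < R" by (simp add: R_def add_nonneg_pos)
  define b where "b = (\<lambda>x. exp (- \<alpha> * (dist x p)^2))"
  define E where "E = exp (- \<alpha> * R^2)"
  have bE: "E < b x" if "dist x p < R" for x
    using that \<alpha> unfolding b_def E_def by (simp add: power_strict_mono)
  define g where "g = (\<lambda>x. m * (b x - E) - z x)"
  have "continuous_on (cball p R) g" unfolding g_def b_def
    by (intro continuous_intros continuous_on_subset[OF cont]) auto
  then obtain x where x: "x \<in> cball p R" "\<And>y. y \<in> cball p R \<Longrightarrow> g y \<le> g x"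
    using continuous_attains_sup[of "cball p R" g] R by fastforce
  have "0 < g q" using bE[of q] zq m by (simp add: g_def R_def)
  also have "g q \<le> g x" using x(2)[of q] by (simp add: R_def dist_commute)
  finally have gx: "0 < g x" .
  have "dist x p \<noteq> R"
    using gx nonneg[of x] m by (auto simp: g_def b_def E_def)
  then have xR: "dist x p < R" using x(1) by (simp add: dist_commute)
  have "b x \<le> 1" using \<alpha> by (simp add: b_def)
  moreover have "0 < E" by (simp add: E_def)
  ultimately have "m * (b x - E) \<le> m * 1" using m by (intro mult_left_mono) auto
  \<comment> \<open>The barrier stays below \<open>m\<close>, and \<open>z\<close> exceeds
    \<open>m\<close> within distance \<open>r\<close> of \<open>p\<close>, so the contact point lies
    where the choice of \<open>\<alpha>\<close> is effective.\<close>
  then have zm: "z x < m" using gx by (simp add: g_def)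
  then have rx: "r \<le> dist x p" using r(2)[of x] by (force simp: m_def)
  have "\<forall>\<^sub>F y in nhds x. y \<in> ball p R"
    using xR by (intro eventually_nhds_in_open) (auto simp: dist_commute)
  then have mx: "\<forall>\<^sub>F y in nhds x. g y \<le> g x"
    by eventually_elim (simp add: x(2))
  have "\<exists>D. lap_at (\<lambda>x. m * (exp (- \<alpha> * (dist x p)^2) - E)) D
      (4 * (m * \<alpha>^2 * exp (- \<alpha> * (dist x p)^2)) * (dist x p)^2
        + 2 * real CARD('n) * (- m * \<alpha> * exp (- \<alpha> * (dist x p)^2))) x"
    by (rule lap_at_radial[where F = "\<lambda>s. m * (exp (- \<alpha> * s) - E)"
          and F' = "\<lambda>s. - m * \<alpha> * exp (- \<alpha> * s)"])
      (auto intro!: always_eventually derivative_eq_intros simp: power2_eq_square)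
  moreover have "4 * (m * \<alpha>^2 * exp (- \<alpha> * (dist x p)^2)) * (dist x p)^2
        + 2 * real CARD('n) * (- m * \<alpha> * exp (- \<alpha> * (dist x p)^2))
      = m * b x * (4 * \<alpha>^2 * (dist x p)^2 - 2 * n * \<alpha>)"
    by (simp add: b_def n_def algebra_simps)
  ultimately obtain D' where lb:
    "lap_at (\<lambda>x. m * (b x - E)) D' (m * b x * (4 * \<alpha>^2 * (dist x p)^2 - 2 * n * \<alpha>)) x"
    by (auto simp: b_def)
  obtain D L where L: "lap_at z D L x" "L \<le> M * z x" using lap by blast
  have K: "m * b x * (4 * \<alpha>^2 * (dist x p)^2 - 2 * n * \<alpha>) \<le> L"
    by (rule lap_at_touching[OF L(1) lb]) (use mx in \<open>simp add: g_def algebra_simps\<close>)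
  have "4 * \<alpha>^2 * r^2 \<le> 4 * \<alpha>^2 * (dist x p)^2"
    using rx r(1) by (intro mult_left_mono power_mono) auto
  then have "\<bar>M\<bar> + 1 \<le> 4 * \<alpha>^2 * (dist x p)^2 - 2 * n * \<alpha>" using \<alpha>r by simp
  then have "m * b x * (\<bar>M\<bar> + 1) \<le> L"
    using K m by (smt (verit) b_def exp_gt_zero mult_left_mono mult_pos_pos)
  also have "L \<le> \<bar>M\<bar> * z x" using L(2) nonneg[of x] by (smt (verit) abs_ge_self mult_right_mono)
  also have "\<dots> \<le> \<bar>M\<bar> * (m * b x)"
    using gx m \<open>0 < E\<close> by (intro mult_left_mono) (auto simp: g_def algebra_simps, smt (verit) mult_pos_pos)
  finally have "m * b x \<le> 0" by (simp add: algebra_simps)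
  then show False using m by (simp add: b_def mult_le_0_iff)
qed

section \<open>A priori bounds for the Allen-Cahn equation\<close>

text \<open>The equation is expressed through \<open>lap_at\<close>, so that \<open>u\<close>,
  \<open>- u\<close> and the tanh profiles are treated alike without verifying \<open>C2\<close> for
  each of them.\<close>

definition AC :: "(real^'n \<Rightarrow> real) \<Rightarrow> bool" where
  "AC u \<longleftrightarrow> continuous_on UNIV u \<and> (\<forall>x. \<exists>D. lap_at u D (u x ^ 3 - u x) x)"

lemma AC_uminus:
  assumes "AC u"
  shows "AC (\<lambda>x. - u x)"
  unfolding AC_def
proof (intro conjI allI)
  show "continuous_on UNIV (\<lambda>x. - u x)" using assms by (auto simp: AC_def intro: continuous_intros)
  fix x
  obtain D where "lap_at u D (u x ^ 3 - u x) x" using assms by (auto simp: AC_def)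
  from lap_at_lin[OF lap_at_inner[of 0 0 x] this, of "-1"]
  show "\<exists>D. lap_at (\<lambda>x. - u x) D ((- u x) ^ 3 - (- u x)) x" by auto
qed

text \<open>Barrier: \<open>1 + M / (R\<^sup>2 - r\<^sup>2)\<close> on the ball of radius \<open>R\<close>, with \<open>M\<close> chosen so that it touches \<open>u\<close> from above.\<close>

lemma AC_le_1:
  fixes u :: "real^'n \<Rightarrow> real"
  assumes "AC u"
  shows "u y \<le> 1"
proof (rule ccontr)
  assume "\<not> u y \<le> 1"
  then have uy: "0 < u y - 1" by simp
  define n where "n = real CARD('n)"
  have n: "0 < n" by (simp add: n_def)
  \<comment> \<open>The barrier will give \<open>M^2 \<le> (2 * n + 8) * R^2\<close>, while the
    value at the centre gives \<open>M^2 \<ge> (u y - 1)^2 * R^4\<close>; this radius makes the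
    latter \<open>(2 * n + 9) * R^2\<close>.\<close>
  define R where "R = sqrt (2 * n + 9) / (u y - 1)"
  have R: "0 < R" using n uy by (simp add: R_def)
  have R2: "(u y - 1)^2 * R^2 = 2 * n + 9" using n uy by (simp add: R_def power_divide)
  \<comment> \<open>The maximum of \<open>G\<close> is the least \<open>M\<close> for which the
    barrier lies above \<open>u\<close>.\<close>
  define G where "G = (\<lambda>x. (u x - 1) * (R^2 - (dist x y)^2))"
  have "continuous_on UNIV u" using assms by (simp add: AC_def)
  then have "continuous_on (cball y R) G" unfolding G_def
    by (intro continuous_intros) (auto intro: continuous_on_subset)
  moreover have Gy: "0 < G y" using uy R by (simp add: G_def)
  moreover have "G x < G y" if "dist x y = R" for x
    using Gy that by (simp add: G_def)
  ultimately obtain x where x: "dist x y < R" "G y \<le> G x" "\<And>z. dist z y \<le> R \<Longrightarrow> G z \<le> G x"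
    using exists_max_cball[of y R G] R by metis
  define M where "M = G x"
  have M: "0 < M" using Gy x(2) by (simp add: M_def)
  have pos: "0 < R^2 - (dist z y)^2" if "dist z y < R" for z
    using that by (simp add: power_strict_mono)
  define \<rho> where "\<rho> = R^2 - (dist x y)^2"
  have \<rho>: "0 < \<rho>" using pos[OF x(1)] by (simp add: \<rho>_def)
  have ux: "u x = M / \<rho> + 1" using \<rho> by (simp add: M_def G_def \<rho>_def)
  have ev: "\<forall>\<^sub>F z in nhds x. z \<in> ball y R"
    using x(1) by (intro eventually_nhds_in_open) (auto simp: dist_commute)
  have "\<exists>D. lap_at (\<lambda>x. M / (R^2 - (dist x y)^2) + 1) D
      (4 * (2 * M / (R^2 - (dist x y)^2)^3) * (dist x y)^2
        + 2 * real CARD('n) * (M / (R^2 - (dist x y)^2)^2)) x"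
  proof (rule lap_at_radial[where F = "\<lambda>s. M / (R^2 - s) + 1" and F' = "\<lambda>s. M / (R^2 - s)^2"])
    show "\<forall>\<^sub>F z in nhds x. ((\<lambda>s. M / (R^2 - s) + 1) has_real_derivative
        M / (R^2 - (dist z y)^2)^2) (at ((dist z y)^2))"
      using ev
    proof eventually_elim
      case (elim z)
      then have "R^2 - (dist z y)^2 \<noteq> 0" using pos[of z] by (simp add: dist_commute)
      then show ?case
        by (auto intro!: derivative_eq_intros simp: power2_eq_square)
    qed
    have "((\<lambda>s. M / (R^2 - s)^2) has_real_derivative
        (0 * \<rho>^2 - M * (2 * \<rho> * (0 - 1))) / (\<rho>^2 * \<rho>^2)) (at ((dist x y)^2))"
      using \<rho> by (auto intro!: derivative_eq_intros simp: \<rho>_def)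
    also have "(0 * \<rho>^2 - M * (2 * \<rho> * (0 - 1))) / (\<rho>^2 * \<rho>^2) = 2 * M / \<rho>^3"
      using \<rho> by (simp add: field_simps power2_eq_square power3_eq_cube)
    finally show "((\<lambda>s. M / (R^2 - s)^2) has_real_derivative
        2 * M / (R^2 - (dist x y)^2)^3) (at ((dist x y)^2))" by (simp add: \<rho>_def)
  qed
  then obtain D where D: "lap_at (\<lambda>x. M / (R^2 - (dist x y)^2) + 1) D
      (4 * (2 * M / \<rho>^3) * (dist x y)^2 + 2 * n * (M / \<rho>^2)) x"
    by (auto simp: \<rho>_def n_def)
  obtain D' where D': "lap_at u D' (u x ^ 3 - u x) x" using assms by (auto simp: AC_def)
  have "\<forall>\<^sub>F z in nhds x. u z \<le> M / (R^2 - (dist z y)^2) + 1"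
    using ev
  proof eventually_elim
    case (elim z)
    then have z: "dist z y < R" by (simp add: dist_commute)
    then have "(u z - 1) * (R^2 - (dist z y)^2) \<le> M" using x(3)[of z] by (simp add: M_def G_def)
    then have "u z - 1 \<le> M / (R^2 - (dist z y)^2)" using pos[OF z] by (simp add: pos_le_divide_eq)
    then show ?case by simp
  qed
  then have "u x ^ 3 - u x \<le> 4 * (2 * M / \<rho>^3) * (dist x y)^2 + 2 * n * (M / \<rho>^2)"
    by (intro lap_at_touching[OF D D']) (simp add: ux flip: \<rho>_def)
  \<comment> \<open>With \<open>k = M / \<rho>\<close> and \<open>u x = 1 + k\<close>, the
    nonlinearity is \<open>k^3 + 3 * k^2 + 2 * k\<close>; its cubic growth beats the
    barrier.\<close>
  moreover have "(M / \<rho>)^3 \<le> u x ^ 3 - u x"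
  proof -
    have "(k + 1) ^ 3 - (k + 1) - k ^ 3 = k * (3 * k + 2)" for k :: real
      by (simp add: algebra_simps power3_eq_cube)
    then have "u x ^ 3 - u x - (M / \<rho>)^3 = (M / \<rho>) * (3 * (M / \<rho>) + 2)"
      unfolding ux .
    moreover have "0 \<le> (M / \<rho>) * (3 * (M / \<rho>) + 2)" using M \<rho> by simp
    ultimately show ?thesis by linarith
  qed
  ultimately have "(M / \<rho>)^3 * \<rho>^3 \<le> (4 * (2 * M / \<rho>^3) * (dist x y)^2 + 2 * n * (M / \<rho>^2)) * \<rho>^3"
    using \<rho> by (intro mult_right_mono) auto
  also have "\<dots> = M * (8 * (dist x y)^2 + 2 * n * \<rho>)"
    using \<rho> by (simp add: field_simps power2_eq_square power3_eq_cube)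
  also have "8 * (dist x y)^2 + 2 * n * \<rho> \<le> 8 * R^2 + 2 * n * R^2"
    using n \<rho> by (intro add_mono mult_left_mono) (auto simp: \<rho>_def)
  finally have "M * M^2 \<le> M * (8 * R^2 + 2 * n * R^2)"
    using M \<rho> by (simp add: power_divide power3_eq_cube power2_eq_square)
  then have 1: "M^2 \<le> 8 * R^2 + 2 * n * R^2" using M by simp
  have "((u y - 1) * R^2)^2 \<le> M^2"
    using x(2) uy by (intro power_mono) (auto simp: G_def M_def)
  also have "((u y - 1) * R^2)^2 = ((u y - 1)^2 * R^2) * R^2"
    by (simp add: power2_eq_square)
  finally have "(2 * n + 9) * R^2 \<le> M^2" unfolding R2 .
  then show False using 1 R by (simp add: algebra_simps) (smt (verit) zero_less_power2)
qed

lemma AC_ge_minus_1: "AC u \<Longrightarrow> - 1 \<le> u y"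
  using AC_le_1[OF AC_uminus, of u y] by simp

text \<open>Barrier: \<open>\<mu> * (1 - r\<^sup>2 / R\<^sup>2)\<^sup>2\<close>, with \<open>\<mu>\<close> chosen so that it touches \<open>u\<close> from below.\<close>

lemma AC_ge_on_large_ball:
  assumes "AC (u :: real^'n \<Rightarrow> real)"
  obtains R where "0 < R" "\<And>y. (\<And>x. dist x y \<le> R \<Longrightarrow> 0 < u x) \<Longrightarrow> 3/4 \<le> u y"
proof -
  define n where "n = real CARD('n)"
  have n: "0 < n" by (simp add: n_def)
  \<comment> \<open>Depends on the dimension alone; its size makes the final inequality read
    \<open>7 * (n + 2)^2 \<le> 4 * n\<close>, which is impossible.\<close>
  define R where "R = 2 * (n + 2)^2"
  have R: "0 < R" using n by (simp add: R_def)
  have "3/4 \<le> u y" if upos: "\<And>x. dist x y \<le> R \<Longrightarrow> 0 < u x" for y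
  proof (rule ccontr)
    assume uy: "\<not> 3/4 \<le> u y"
    define c where "c = 1 / R^2"
    have c: "c * R^2 = 1" using R by (simp add: c_def)
    define t where "t = (\<lambda>x. 1 - c * (dist x y)^2)"
    \<comment> \<open>The maximum of \<open>G\<close> is \<open>1 / \<mu>\<close> for the largest
      \<open>\<mu>\<close> with \<open>\<mu> * (t x)^2 \<le> u x\<close> on the ball; comparison at
      the centre gives \<open>\<mu> \<le> u y\<close>.\<close>
    define G where "G = (\<lambda>x. (t x)^2 / u x)"
    have "continuous_on UNIV u" using assms by (simp add: AC_def)
    moreover have "u x \<noteq> 0" if "x \<in> cball y R" for x using upos[of x] that by (simp add: dist_commute)
    ultimately have "continuous_on (cball y R) G" unfolding G_def t_def using R
      by (intro continuous_intros) (auto intro: continuous_on_subset)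
    moreover have Gy: "G y = 1 / u y" "0 < u y" using upos[of y] R by (auto simp: G_def t_def)
    moreover have "G x < G y" if "dist x y = R" for x
      using Gy that c by (simp add: G_def t_def)
    ultimately obtain x where x: "dist x y < R" "G y \<le> G x" "\<And>z. dist z y \<le> R \<Longrightarrow> G z \<le> G x"
      using exists_max_cball[of y R G] R by metis
    have ux: "0 < u x" using upos[of x] x(1) by simp
    have "(dist x y)^2 < R^2" using x(1) by (simp add: power_strict_mono)
    then have t: "0 < t x" "t x \<le> 1" using R by (auto simp: t_def c_def)
    define \<mu> where "\<mu> = u x / (t x)^2"
    have \<mu>: "0 < \<mu>" using ux t by (simp add: \<mu>_def)
    have u\<mu>: "u x = \<mu> * (t x)^2" using t by (simp add: \<mu>_def)
    have "G x = 1 / \<mu>" using t by (simp add: G_def \<mu>_def)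
    then have "1 / u y \<le> 1 / \<mu>" using x(2) Gy(1) by simp
    then have "\<mu> \<le> u y" using Gy(2) \<mu> by (simp add: field_simps)
    then have \<mu>34: "\<mu> < 3/4" using uy by simp
    have "\<exists>D. lap_at (\<lambda>x. \<mu> * (1 - c * (dist x y)^2)^2) D
       (4 * (2 * \<mu> * c^2) * (dist x y)^2
        + 2 * real CARD('n) * (- 2 * \<mu> * c * (1 - c * (dist x y)^2))) x"
      by (rule lap_at_radial[where F = "\<lambda>s. \<mu> * (1 - c * s)^2"
            and F' = "\<lambda>s. - 2 * \<mu> * c * (1 - c * s)"])
        (auto intro!: always_eventually derivative_eq_intros simp: power2_eq_square algebra_simps)
    moreover have "4 * (2 * \<mu> * c^2) * (dist x y)^2
        + 2 * real CARD('n) * (- 2 * \<mu> * c * (1 - c * (dist x y)^2))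
      = \<mu> * (c * (8 * (1 - t x) - 4 * n * t x))"
      by (simp add: t_def n_def power2_eq_square algebra_simps)
    ultimately obtain D where D: "lap_at (\<lambda>x. \<mu> * (t x)^2) D (\<mu> * ((8 * (1 - t x) - 4 * n * t x) / R^2)) x"
      by (auto simp: t_def c_def)
    obtain D' where D': "lap_at u D' (u x ^ 3 - u x) x" using assms by (auto simp: AC_def)
    have "\<forall>\<^sub>F z in nhds x. z \<in> ball y R"
      using x(1) by (intro eventually_nhds_in_open) (auto simp: dist_commute)
    then have "\<forall>\<^sub>F z in nhds x. \<mu> * (t z)^2 \<le> u z"
    proof eventually_elim
      case (elim z)
      then have z: "dist z y \<le> R" by (simp add: dist_commute)
      have "(t z)^2 / u z \<le> 1 / \<mu>" using x(3)[OF z] \<open>G x = 1 / \<mu>\<close> by (simp add: G_def)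
      then show ?case using \<mu> upos[OF z] by (simp add: field_simps)
    qed
    then have "\<mu> * ((8 * (1 - t x) - 4 * n * t x) / R^2) \<le> u x ^ 3 - u x"
      by (intro lap_at_touching[OF D' D]) (simp add: u\<mu>)
    also have "u x ^ 3 - u x = \<mu> * ((u x ^ 2 - 1) * (t x)^2)"
      by (simp add: u\<mu> algebra_simps power2_eq_square power3_eq_cube)
    finally have "(8 * (1 - t x) - 4 * n * t x) / R^2 \<le> (u x ^ 2 - 1) * (t x)^2"
      using \<mu> by (rule mult_left_le_imp_le)
    then have le: "R^2 * ((1 - u x ^ 2) * (t x)^2) \<le> 4 * n * t x - 8 * (1 - t x)"
      using R by (simp add: field_simps)
    have "u x \<le> \<mu> * 1" unfolding u\<mu> using t \<mu> by (intro mult_left_mono) (auto simp: power_le_one)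
    then have "(u x)^2 \<le> (3/4)^2" using \<mu>34 ux by (intro power_mono) auto
    then have u2: "7/16 \<le> 1 - (u x)^2" by (simp add: power2_eq_square)
    have "0 < R^2 * ((1 - u x ^ 2) * (t x)^2)" using R t u2 by simp
    \<comment> \<open>The right-hand side of \<open>le\<close> must be positive. This bounds
      \<open>t x\<close> below, keeping the contact point away from the sphere where the barrier
      degenerates.\<close>
    then have "2 < t x * (n + 2)"
      using le n t(1) by (simp add: algebra_simps)
    then have "2^2 < (t x * (n + 2))^2" by (intro power_strict_mono) auto
    then have "4 < (t x)^2 * (n + 2)^2" by (simp add: power_mult_distrib)
    then have "4 * (n + 2)^2 < (t x)^2 * (n + 2)^2 * (n + 2)^2"
      using n by (intro mult_strict_right_mono) auto
    moreover have "R^2 = 4 * ((n + 2)^2 * (n + 2)^2)"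
      by (simp add: R_def power_mult_distrib power2_eq_square)
    ultimately have "16 * (n + 2)^2 < R^2 * (t x)^2" by (simp add: algebra_simps)
    then have "7/16 * (16 * (n + 2)^2) \<le> 7/16 * (R^2 * (t x)^2)" by simp
    also have "\<dots> \<le> (1 - u x ^ 2) * (R^2 * (t x)^2)"
      using u2 by (intro mult_right_mono) auto
    also have "\<dots> \<le> 4 * n * t x - 8 * (1 - t x)" using le by (simp add: algebra_simps)
    also have "\<dots> \<le> 4 * n" using t n by (smt (verit) mult_left_le)
    finally show False using n by (simp add: power2_eq_square algebra_simps) (smt (verit) mult_pos_pos)
  qed
  with R that show thesis by blast
qed

section \<open>Comparison of two solutions\<close>

text \<open>The difference \<open>w - u\<close> has Laplacian
  \<open>(w^2 + w * u + u^2 - 1) * (w - u)\<close>. Where it is positive, \<open>*\<close> puts both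
  values above 3/4 or both below -3/4 (weakly), so the coefficient is at least 1/2 and
  \<open>max_principle\<close> applies.\<close>

lemma AC_comparison:
  assumes u: "AC u" and w: "AC w"
    and *: "\<And>x. u x < w x \<Longrightarrow> 3/4 \<le> u x \<or> w x \<le> - 3/4"
  shows "w x \<le> u x"
proof -
  have "w x + (-1) * u x \<le> 0"
  proof (rule max_principle[where B = 2 and c = "1/2"])
    show "continuous_on UNIV (\<lambda>x. w x + (-1) * u x)"
      using u w by (auto simp: AC_def intro!: continuous_intros)
    show "w x + (-1) * u x \<le> 2" for x
      using AC_le_1[OF w, of x] AC_ge_minus_1[OF u, of x] by simp
    fix x assume pos: "0 < w x + (-1) * u x"
    obtain D E where DE: "lap_at u D (u x ^ 3 - u x) x" "lap_at w E (w x ^ 3 - w x) x"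
      using u w by (auto simp: AC_def) blast
    have prod: "9/16 \<le> b * d" if "3/4 \<le> b" "3/4 \<le> d" for b d :: real
      using mult_mono[of "3/4" b "3/4" d] that by simp
    have "27/16 \<le> w x * w x + w x * u x + u x * u x"
    proof (cases "3/4 \<le> u x")
      case True
      then have "9/16 \<le> w x * w x" "9/16 \<le> w x * u x" "9/16 \<le> u x * u x"
        using pos prod[of "w x" "w x"] prod[of "w x" "u x"] prod[of "u x" "u x"] by simp_all
      then show ?thesis by simp
    next
      case False
      then have "3/4 \<le> - w x" using *[of x] pos by simp
      then show ?thesis
        using pos prod[of "- w x" "- w x"] prod[of "- w x" "- u x"] prod[of "- u x" "- u x"] by simp
    qed
    then have "1/2 \<le> w x * w x + w x * u x + u x * u x - 1" by simp
    then have "1/2 * (w x + (-1) * u x) \<le> (w x * w x + w x * u x + u x * u x - 1) * (w x + (-1) * u x)"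
      using pos by (intro mult_right_mono) auto
    also have "\<dots> = (w x ^ 3 - w x) + (-1) * (u x ^ 3 - u x)"
      by (simp add: algebra_simps power3_eq_cube)
    finally show "\<exists>D L. lap_at (\<lambda>x. w x + (-1) * u x) D L x \<and> 1/2 * (w x + (-1) * u x) \<le> L"
      using lap_at_lin[OF DE(2,1), of "-1"] by blast
  qed simp
  then show ?thesis by simp
qed

text \<open>Both solutions are bounded by 1 in absolute value, so the coefficient of
  \<open>u - w\<close> in the equation for the difference is at most 2 and
  \<open>strong_max_principle\<close> applies.\<close>

lemma AC_strict:
  assumes u: "AC u" and w: "AC w" and le: "\<And>x. w x \<le> u x" and p: "w p < u p"
  shows "w q < u q"
proof -
  have "0 < u q + (-1) * w q"
  proof (rule strong_max_principle[where M = 2 and p = p])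
    show "continuous_on UNIV (\<lambda>x. u x + (-1) * w x)"
      using u w by (auto simp: AC_def intro!: continuous_intros)
    show "0 \<le> u x + (-1) * w x" for x using le by simp
    show "0 < u p + (-1) * w p" using p by simp
    fix x
    obtain D E where DE: "lap_at u D (u x ^ 3 - u x) x" "lap_at w E (w x ^ 3 - w x) x"
      using u w by (auto simp: AC_def) blast
    have b: "\<bar>u x\<bar> \<le> 1" "\<bar>w x\<bar> \<le> 1"
      using AC_le_1[OF u, of x] AC_ge_minus_1[OF u, of x] AC_le_1[OF w, of x] AC_ge_minus_1[OF w, of x]
      by auto
    have prod: "a * b \<le> 1" if "\<bar>a\<bar> \<le> 1" "\<bar>b\<bar> \<le> 1" for a b :: real
      using mult_mono[OF that] abs_ge_self[of "a * b"] by (simp add: abs_mult)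
    have "u x * u x + u x * w x + w x * w x - 1 \<le> 2"
      using prod[OF b(1,1)] prod[OF b] prod[OF b(2,2)] by simp
    then have le2: "(u x * u x + u x * w x + w x * w x - 1) * (u x - w x) \<le> 2 * (u x - w x)"
      using le[of x] by (intro mult_right_mono) auto
    have "(u x ^ 3 - u x) + (-1) * (w x ^ 3 - w x)
        = (u x * u x + u x * w x + w x * w x - 1) * (u x - w x)"
      by (simp add: algebra_simps power3_eq_cube)
    also note le2
    also have "2 * (u x - w x) = 2 * (u x + (-1) * w x)" by simp
    finally show "\<exists>D L. lap_at (\<lambda>x. u x + (-1) * w x) D L x \<and> L \<le> 2 * (u x + (-1) * w x)"
      using lap_at_lin[OF DE, of "-1"] by blast
  qed
  then show ?thesis by simp
qed

section \<open>The one-dimensional profile and the sliding argument\<close>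

text \<open>The profile satisfies \<open>T'' = T^3 - T\<close>, and the linear function inside it
  has unit gradient and zero Laplacian.\<close>

lemma AC_tanh:
  assumes "norm e = 1"
  shows "AC (\<lambda>x. tanh ((\<tau> - e \<bullet> (x - a)) / sqrt 2))"
  unfolding AC_def
proof (intro conjI allI)
  show "continuous_on UNIV (\<lambda>x. tanh ((\<tau> - e \<bullet> (x - a)) / sqrt 2))"
    by (intro continuous_intros) auto
  fix x
  let ?T = "\<lambda>s. tanh ((\<tau> - s) / sqrt 2)"
  have T': "(?T has_real_derivative - (1 - (?T s)^2) / sqrt 2) (at s)" for s
    by (auto intro!: derivative_eq_intros simp: field_simps)
  have "((\<lambda>s. - (1 - (?T s)^2) / sqrt 2) has_real_derivative
      (2 * ?T s * (- (1 - (?T s)^2) / sqrt 2)) / sqrt 2) (at s)" for s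
    by (rule derivative_eq_intros T' refl | simp)+
  moreover have "(2 * ?T s * (- (1 - (?T s)^2) / sqrt 2)) / sqrt 2 = ?T s ^ 3 - ?T s" for s
  proof -
    have "(2 * t * (- (1 - t^2) / sqrt 2)) / sqrt 2 = t ^ 3 - t" for t :: real
    proof -
      have "(2 * t * (- (1 - t^2) / sqrt 2)) / sqrt 2 = (2 * t * (t^2 - 1)) / (sqrt 2 * sqrt 2)"
        by (simp add: algebra_simps)
      also have "\<dots> = t ^ 3 - t" by (simp add: field_simps power3_eq_cube power2_eq_square)
      finally show ?thesis .
    qed
    then show ?thesis .
  qed
  ultimately have T'': "((\<lambda>s. - (1 - (?T s)^2) / sqrt 2) has_real_derivative (?T s ^ 3 - ?T s)) (at s)" for s
    by simp
  have "e \<bullet> e = 1" using assms by (simp add: norm_eq_1)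
  with lap_at_chain[OF lap_at_inner[of e a x] always_eventually[OF allI[OF T']] T'']
  show "\<exists>D. lap_at (\<lambda>x. ?T (e \<bullet> (x - a))) D (?T (e \<bullet> (x - a)) ^ 3 - ?T (e \<bullet> (x - a))) x"
    by auto
qed

text \<open>Controls how much the sliding profile rises when its parameter increases:
  \<open>z - tanh z\<close> has derivative \<open>(tanh z)^2\<close>.\<close>

lemma tanh_real_diff_le:
  fixes x y :: real
  assumes "x \<le> y"
  shows "tanh y - tanh x \<le> y - x"
proof -
  have "x - tanh x \<le> y - tanh y"
    using assms
  proof (rule DERIV_nonneg_imp_nondecreasing)
    fix z :: real
    have "((\<lambda>z. z - tanh z) has_real_derivative (tanh z)^2) (at z)"
      by (auto intro!: derivative_eq_intros)
    then show "\<exists>d. ((\<lambda>z. z - tanh z) has_real_derivative d) (at z) \<and> 0 \<le> d" by force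
  qed
  then show ?thesis by simp
qed

lemma AC_positive_off_cone:
  fixes u :: "real^'n \<Rightarrow> real"
  assumes n2: "2 \<le> CARD('n)" and u: "AC u" and e: "norm e = 1" and \<beta>: "0 < \<beta>"
    and pos: "\<And>x. e \<bullet> (x - a) < \<beta> * norm (x - a - (e \<bullet> (x - a)) *\<^sub>R e) \<Longrightarrow> 0 < u x"
  shows "u x = 1"
proof -
  define s where "s = (\<lambda>x. e \<bullet> (x - a))"
  define w where "w = (\<lambda>\<tau> x. tanh ((\<tau> - s x) / sqrt 2))"
  have w: "AC (w \<tau>)" for \<tau> unfolding w_def s_def by (rule AC_tanh[OF e])
  have s_lip: "\<bar>s x - s y\<bar> \<le> dist x y" for x y
    using Cauchy_Schwarz_ineq2[of e "x - y"] e
    by (simp add: s_def dist_norm inner_diff_right)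
  obtain L where L: "0 < L" "\<And>y. (\<And>x. dist x y \<le> L \<Longrightarrow> 0 < u x) \<Longrightarrow> 3/4 \<le> u y"
    using AC_ge_on_large_ball[OF u] by blast
  have neg: "3/4 \<le> u x" if "s x + L < 0" for x
  proof (rule L(2), rule pos)
    fix z assume "dist z x \<le> L"
    then have "s z < 0" using s_lip[of z x] that by simp
    also have "0 \<le> \<beta> * norm (z - a - (e \<bullet> (z - a)) *\<^sub>R e)" using \<beta> by simp
    finally show "e \<bullet> (z - a) < \<beta> * norm (z - a - (e \<bullet> (z - a)) *\<^sub>R e)" by (simp add: s_def)
  qed
  \<comment> \<open>A point of the cone with height at most \<open>\<bar>R\<bar> + L\<close> is
    within \<open>(\<bar>R\<bar> + L) * (1 / \<beta> + 1)\<close> of the vertex; \<open>L\<close> is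
    the radius of the ball to be kept off the cone, and the 1 gives strictness.\<close>
  define \<rho> where "\<rho> = (\<lambda>R. L + (\<bar>R\<bar> + L) * (1 / \<beta> + 1) + 1)"
  have far: "3/4 \<le> u x" if "s x \<le> R" "\<rho> R \<le> dist x a" for x R
  proof (rule L(2), rule ccontr)
    fix z assume z: "dist z x \<le> L" "\<not> 0 < u z"
    let ?v = "z - a - s z *\<^sub>R e"
    have 1: "\<beta> * norm ?v \<le> s z" using pos[of z] z(2) by (force simp: s_def)
    have 2: "s z \<le> \<bar>R\<bar> + L" using s_lip[of z x] z(1) that(1) by simp
    have 3: "0 \<le> s z" using 1 \<beta> by (smt (verit) mult_nonneg_nonneg norm_ge_zero)
    have "norm ?v \<le> (\<bar>R\<bar> + L) / \<beta>" using 1 2 \<beta> by (simp add: field_simps)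
    moreover have "dist z a \<le> norm ?v + norm (s z *\<^sub>R e)"
      using norm_triangle_ineq[of ?v "s z *\<^sub>R e"] by (simp add: dist_norm)
    moreover have "norm (s z *\<^sub>R e) = s z" using 3 e by simp
    moreover have "dist x a \<le> dist z x + dist z a" by (metis dist_commute dist_triangle)
    ultimately have "dist x a \<le> L + ((\<bar>R\<bar> + L) / \<beta> + (\<bar>R\<bar> + L))" using 2 z(1) by simp
    then show False using that(2) by (simp add: \<rho>_def algebra_simps add_divide_distrib)
  qed
  obtain C where C: "\<And>y. C \<le> y \<Longrightarrow> 3/4 \<le> tanh (y / sqrt 2)"
  proof -
    have "\<forall>\<^sub>F y in at_top. 3/4 < tanh (y::real)"
      by (rule order_tendstoD(1)[OF tanh_real_at_top]) simp
    then obtain N where N: "\<And>y. N \<le> y \<Longrightarrow> 3/4 < tanh (y::real)"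
      unfolding eventually_at_top_linorder by blast
    have "3/4 \<le> tanh (y / sqrt 2)" if "N * sqrt 2 \<le> y" for y
      using N[of "y / sqrt 2"] that by (simp add: field_simps)
    then show thesis using that by blast
  qed
  have w_neg: "w \<tau> x \<le> - 3/4" if "\<tau> + C \<le> s x" for \<tau> x
  proof -
    have "w \<tau> x = - tanh ((s x - \<tau>) / sqrt 2)"
      unfolding w_def by (metis minus_diff_eq minus_divide_left tanh_minus)
    then show ?thesis using C[of "s x - \<tau>"] that by simp
  qed
  have w_mono: "w \<sigma> x \<le> w \<tau> x" if "\<sigma> \<le> \<tau>" for \<sigma> \<tau> x
    using that by (simp add: w_def divide_right_mono)
  define S where "S = {\<tau>. \<forall>x. w \<tau> x \<le> u x}"
  \<comment> \<open>The start of the sliding: below height \<open>-L\<close> the solution is at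
    least 3/4, and from height \<open>-L - 1\<close> on the profile is at most -3/4, so the two
    regions cover the space.\<close>
  have "- L - 1 - C \<in> S"
    unfolding S_def
  proof (intro CollectI allI AC_comparison[OF u w])
    fix x show "3/4 \<le> u x \<or> w (- L - 1 - C) x \<le> - 3/4"
      using neg[of x] w_neg[of "- L - 1 - C" x] by linarith
  qed
  then have Sne: "S \<noteq> {}" by blast
  have "\<not> bdd_above S"
  proof
    assume bdd: "bdd_above S"
    define T where "T = Sup S"
    have below: "\<tau> \<in> S" if \<tau>: "\<tau> < T" for \<tau>
    proof -
      obtain \<sigma> where \<sigma>: "\<sigma> \<in> S" "\<tau> < \<sigma>"
        using \<tau> Sne bdd less_cSup_iff[of S \<tau>] unfolding T_def by blast
      have "w \<tau> x \<le> u x" for x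
        using order_trans[OF w_mono[of \<tau> \<sigma> x]] \<sigma> by (simp add: S_def)
      then show ?thesis by (simp add: S_def)
    qed
    \<comment> \<open>The supremum is attained because the profile is continuous in its
      parameter.\<close>
    have TS: "w T x \<le> u x" for x
    proof (rule tendsto_upperbound)
      show "((\<lambda>\<tau>. w \<tau> x) \<longlongrightarrow> w T x) (at_left T)"
        unfolding w_def by (intro tendsto_intros) auto
      show "\<forall>\<^sub>F \<tau> in at_left T. w \<tau> x \<le> u x"
        unfolding eventually_at_filter by (intro always_eventually) (use below in \<open>auto simp: S_def\<close>)
    qed simp
    \<comment> \<open>Dimension at least 2 enters here: the zero hyperplane of \<open>w T\<close>
      contains points arbitrarily far from \<open>a\<close>, where \<open>u\<close> is at least
      3/4.\<close>
    obtain d where d: "d \<noteq> 0" "orthogonal e d"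
      using orthogonal_to_vector_exists[of e] n2 by auto
    \<comment> \<open>The summand \<open>\<bar>T\<bar>\<close> absorbs the component
      \<open>T *\<^sub>R e\<close> in the triangle inequality for the distance to
      \<open>a\<close>.\<close>
    define q where "q = a + T *\<^sub>R e + ((\<bar>T\<bar> + \<bar>\<rho> T\<bar>) / norm d) *\<^sub>R d"
    have "s q = T" using d(2) e
      by (simp add: s_def q_def inner_add_right orthogonal_def norm_eq_1)
    have "3/4 \<le> u q"
    proof (rule far)
      have "norm (((\<bar>T\<bar> + \<bar>\<rho> T\<bar>) / norm d) *\<^sub>R d) \<le> norm (q - a) + norm (T *\<^sub>R e)"
        using norm_triangle_ineq4[of "q - a" "T *\<^sub>R e"] by (simp add: q_def)
      then show "\<rho> T \<le> dist q a" using d(1) e by (simp add: dist_norm)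
    qed (simp add: \<open>s q = T\<close>)
    then have "w T q < u q" by (simp add: w_def \<open>s q = T\<close>)
    then have strict: "w T x < u x" for x using AC_strict[OF u w TS] by blast
    \<comment> \<open>Outside this ball \<open>far\<close> covers all heights up to
      \<open>T + 1 + C\<close>; on it, compactness gives a positive gap between \<open>w T\<close>
      and \<open>u\<close>.\<close>
    define D where "D = cball a \<bar>\<rho> (T + 1 + C)\<bar>"
    have "continuous_on D (\<lambda>x. u x - w T x)"
      using u w[of T] unfolding AC_def by (intro continuous_intros) (auto intro: continuous_on_subset)
    moreover have "compact D" "D \<noteq> {}" by (auto simp: D_def)
    ultimately obtain x0 where x0: "\<And>x. x \<in> D \<Longrightarrow> u x0 - w T x0 \<le> u x - w T x"
      using continuous_attains_inf[of D "\<lambda>x. u x - w T x"] by blast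
    \<comment> \<open>The gap bounds the rise of the profile, so no crossing occurs on
      \<open>D\<close>; the cap 1 ensures that above height \<open>T + 1 + C\<close> the raised
      profile is still at most -3/4.\<close>
    define \<epsilon> where "\<epsilon> = min 1 (u x0 - w T x0)"
    have \<epsilon>: "0 < \<epsilon>" "\<epsilon> \<le> 1" "\<epsilon> \<le> u x0 - w T x0" using strict[of x0] by (auto simp: \<epsilon>_def)
    have "T + \<epsilon> \<in> S"
      unfolding S_def
    proof (intro CollectI allI AC_comparison[OF u w])
      fix x assume ux: "u x < w (T + \<epsilon>) x"
      have "w (T + \<epsilon>) x - w T x \<le> (T + \<epsilon> - s x) / sqrt 2 - (T - s x) / sqrt 2"
        unfolding w_def using \<epsilon> by (intro tanh_real_diff_le divide_right_mono) auto
      also have "\<dots> = \<epsilon> / sqrt 2" by (simp add: field_simps)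
      also have "\<dots> \<le> \<epsilon> / 1" using \<epsilon> by (intro divide_left_mono) auto
      finally have "u x - w T x < u x0 - w T x0" using ux \<epsilon> by simp
      then have "x \<notin> D" using x0[of x] by force
      then have "\<rho> (T + 1 + C) \<le> dist x a" by (simp add: D_def dist_commute)
      then show "3/4 \<le> u x \<or> w (T + \<epsilon>) x \<le> - 3/4"
        using far[of x "T + 1 + C"] w_neg[of "T + \<epsilon>" x] \<epsilon> by linarith
    qed
    then have "T + \<epsilon> \<le> T" unfolding T_def using bdd by (rule cSup_upper)
    then show False using \<epsilon> by simp
  qed
  then have all: "w \<tau> x \<le> u x" for \<tau> x
  proof -
    obtain \<sigma> where "\<sigma> \<in> S" "\<tau> \<le> \<sigma>"
      using \<open>\<not> bdd_above S\<close> unfolding bdd_above_def by (meson linear)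
    then show ?thesis using order_trans[OF w_mono[of \<tau> \<sigma> x]] by (simp add: S_def)
  qed
  have "1 \<le> u x"
  proof (rule tendsto_upperbound)
    have "filterlim (\<lambda>\<tau>. (\<tau> - s x) / sqrt 2) at_top at_top"
      unfolding filterlim_at_top
    proof
      fix Z
      show "\<forall>\<^sub>F \<tau> in at_top. Z \<le> (\<tau> - s x) / sqrt 2"
        using eventually_ge_at_top[of "Z * sqrt 2 + s x"]
        by eventually_elim (simp add: pos_le_divide_eq)
    qed
    then show "((\<lambda>\<tau>. w \<tau> x) \<longlongrightarrow> 1) at_top"
      unfolding w_def by (rule filterlim_compose[OF tanh_real_at_top])
    show "\<forall>\<^sub>F \<tau> in at_top. w \<tau> x \<le> u x" using all by simp
  qed simp
  then show ?thesis using AC_le_1[OF u, of x] by simp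
qed

section \<open>Geometry of the cone and conclusion\<close>

text \<open>Moving in direction \<open>- e\<close> lowers the height and keeps the distance to the
  axis, so each point is joined inside the complement to the half-space \<open>H\<close>. The
  connected sets \<open>A x\<close> all contain \<open>a - e\<close>.\<close>

lemma connected_cone_complement:
  fixes e a :: "'a::euclidean_space"
  assumes e: "norm e = 1" and \<beta>: "0 < \<beta>"
  shows "connected {x. e \<bullet> (x - a) < \<beta> * norm (x - a - (e \<bullet> (x - a)) *\<^sub>R e)}" (is "connected ?W")
proof -
  have ee: "e \<bullet> e = 1" using e by (simp add: norm_eq_1)
  define H where "H = {x. e \<bullet> (x - a) < 0}"
  define A where "A = (\<lambda>x. H \<union> closed_segment x (x - (\<bar>e \<bullet> (x - a)\<bar> + 1) *\<^sub>R e))"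
  have HW: "H \<subseteq> ?W"
  proof
    fix x assume "x \<in> H"
    moreover have "0 \<le> \<beta> * norm (x - a - (e \<bullet> (x - a)) *\<^sub>R e)" using \<beta> by simp
    ultimately show "x \<in> ?W" unfolding H_def by auto
  qed
  have AW: "A x \<subseteq> ?W" if "x \<in> ?W" for x
  proof -
    have "z \<in> ?W" if z: "z \<in> closed_segment x (x - (\<bar>e \<bullet> (x - a)\<bar> + 1) *\<^sub>R e)" for z
    proof -
      obtain r where r: "z = x - (r * (\<bar>e \<bullet> (x - a)\<bar> + 1)) *\<^sub>R e" "0 \<le> r"
        using z unfolding in_segment by (auto simp: algebra_simps)
      define t where "t = r * (\<bar>e \<bullet> (x - a)\<bar> + 1)"
      have t: "z = x - t *\<^sub>R e" "0 \<le> t" using r by (auto simp: t_def)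
      have s: "e \<bullet> (z - a) = e \<bullet> (x - a) - t"
        using ee by (simp add: t inner_diff_right)
      have v: "z - a - (e \<bullet> (z - a)) *\<^sub>R e = x - a - (e \<bullet> (x - a)) *\<^sub>R e"
        unfolding s by (simp add: t algebra_simps)
      have "e \<bullet> (z - a) < \<beta> * norm (x - a - (e \<bullet> (x - a)) *\<^sub>R e)"
        using s t(2) \<open>x \<in> ?W\<close> by simp
      then show ?thesis by (simp only: mem_Collect_eq v)
    qed
    then show ?thesis using HW by (auto simp: A_def)
  qed
  have "connected (A x)" for x
    unfolding A_def
  proof (rule connected_Un)
    have "H = {x. e \<bullet> x < e \<bullet> a}" by (auto simp: H_def inner_diff_right)
    then show "connected H" by (simp add: convex_connected convex_halfspace_lt)
    have "x - (\<bar>e \<bullet> (x - a)\<bar> + 1) *\<^sub>R e \<in> H"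
      using ee by (simp add: H_def inner_diff_right)
    then show "H \<inter> closed_segment x (x - (\<bar>e \<bullet> (x - a)\<bar> + 1) *\<^sub>R e) \<noteq> {}" by auto
  qed simp
  moreover have "a - e \<in> A x" for x using ee by (simp add: A_def H_def)
  then have "\<Inter>(A ` ?W) \<noteq> {}" by blast
  ultimately have "connected (\<Union>(A ` ?W))" by (intro connected_Union) auto
  moreover have "\<Union>(A ` ?W) = ?W"
  proof
    show "\<Union>(A ` ?W) \<subseteq> ?W" using AW by blast
    show "?W \<subseteq> \<Union>(A ` ?W)" unfolding A_def by blast
  qed
  ultimately show ?thesis by simp
qed

lemma AC_if_allen_cahn_solution:
  assumes "allen_cahn_solution u"
  shows "AC u"
  unfolding AC_def
proof (intro conjI allI)
  have C2: "C2 u" using assms by (simp add: allen_cahn_solution_def)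
  then show "continuous_on UNIV u"
    by (auto simp: C2_def C1_def continuous_on_eq_continuous_at intro: differentiable_imp_continuous_within)
  fix x
  have "laplacian u x = u x ^ 3 - u x"
    using assms by (simp add: allen_cahn_solution_def) (smt (verit))
  then show "\<exists>D. lap_at u D (u x ^ 3 - u x) x" using lap_at_C2[OF C2, of x] by auto
qed

text \<open>Replaces the rotated coordinates by the unit axis \<open>e\<close>, the image of the
  \<open>k\<close>-th basis vector: an orthogonal map preserves both the height and the norm of the
  component orthogonal to the axis.\<close>

lemma nondegenerate_cone_axis:
  assumes "nondegenerate_cone (S :: (real^'n) set)"
  obtains e a \<beta> where "norm e = 1" "0 < \<beta>"
    "\<And>y. y \<in> S \<Longrightarrow> \<beta> * norm (y - a - (e \<bullet> (y - a)) *\<^sub>R e) \<le> e \<bullet> (y - a)"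
proof -
  obtain k \<beta> Q a where \<beta>: "\<beta> > 0" and Q: "rotation_matrix Q"
    and S: "S = (\<lambda>x. a + Q *v x) ` standard_cone k \<beta>"
    using assms unfolding nondegenerate_cone_def by blast
  have orth: "orthogonal_transformation ((*v) Q)"
    using Q by (simp add: rotation_matrix_def orthogonal_transformation_matrix)
  define e where "e = Q *v axis k 1"
  have "norm e = 1" unfolding e_def using orthogonal_transformation_norm[OF orth] by simp
  moreover have "\<beta> * norm (y - a - (e \<bullet> (y - a)) *\<^sub>R e) \<le> e \<bullet> (y - a)" if y: "y \<in> S" for y
  proof -
    obtain x where x: "x \<in> standard_cone k \<beta>" "y = a + Q *v x" using y unfolding S by blast
    have 1: "e \<bullet> (y - a) = x $ k"
      using orth by (simp add: x e_def orthogonal_transformation_def inner_axis')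
    have "y - a - (e \<bullet> (y - a)) *\<^sub>R e = Q *v (x - (x $ k) *\<^sub>R axis k 1)"
      unfolding 1 by (simp add: x e_def matrix_vector_mult_diff_distrib matrix_vector_mult_scaleR)
    also have "norm \<dots> = norm (x - (x $ k) *\<^sub>R axis k 1)"
      by (rule orthogonal_transformation_norm[OF orth])
    also have "x - (x $ k) *\<^sub>R axis k 1 = (\<chi> i. if i = k then 0 else x $ i)"
      by (simp add: vec_eq_iff axis_def)
    finally show ?thesis using x(1) unfolding 1 by (simp add: standard_cone_def)
  qed
  ultimately show thesis using that \<beta> by blast
qed

theorem corollary4:
  fixes u :: "real^'n \<Rightarrow> real"
  assumes "CARD('n) \<ge> 2"
    and "allen_cahn_solution u"
    and "\<not> u constant_on UNIV"
  shows "\<not> (\<exists>S. nondegenerate_cone S \<and> {x. u x = 0} \<subseteq> S)"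
proof
  assume "\<exists>S. nondegenerate_cone S \<and> {x. u x = 0} \<subseteq> S"
  then obtain S where S: "nondegenerate_cone S" "{x. u x = 0} \<subseteq> S" by blast
  obtain e a \<beta> where e: "norm e = 1" and \<beta>: "0 < \<beta>"
    and cone: "\<And>y. y \<in> S \<Longrightarrow> \<beta> * norm (y - a - (e \<bullet> (y - a)) *\<^sub>R e) \<le> e \<bullet> (y - a)"
    by (rule nondegenerate_cone_axis[OF S(1)]) (rule that)
  have AC: "AC u" using assms(2) by (rule AC_if_allen_cahn_solution)
  define W where "W = {x. e \<bullet> (x - a) < \<beta> * norm (x - a - (e \<bullet> (x - a)) *\<^sub>R e)}"
  have "continuous_on W u" using AC by (auto simp: AC_def intro: continuous_on_subset)
  moreover have "connected W" unfolding W_def using e \<beta> by (rule connected_cone_complement)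
  ultimately have conn: "connected (u ` W)" by (rule connected_continuous_image)
  have zW: "0 \<notin> u ` W"
  proof
    assume "0 \<in> u ` W"
    then obtain x where "x \<in> W" "u x = 0" by auto
    then show False using cone[of x] S(2) by (force simp: W_def)
  qed
  have "(\<forall>x\<in>W. 0 < u x) \<or> (\<forall>x\<in>W. u x < 0)"
  proof (rule ccontr)
    assume "\<not> ?thesis"
    then obtain x y where "x \<in> W" "u x \<le> 0" "y \<in> W" "0 \<le> u y" by (auto simp: not_less)
    then show False using connectedD_interval[OF conn, of "u x" "u y" 0] zW by simp
  qed
  then have "\<exists>c. \<forall>x. u x = c"
  proof
    assume W: "\<forall>x\<in>W. 0 < u x"
    have "u x = 1" for x
      by (rule AC_positive_off_cone[OF assms(1) AC e \<beta>, of a]) (use W in \<open>simp add: W_def\<close>)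
    then show ?thesis by blast
  next
    assume W: "\<forall>x\<in>W. u x < 0"
    \<comment> \<open>The equation is odd, so the negative case reduces to the positive one for
      \<open>- u\<close>.\<close>
    have m: "- u x = 1" for x
      by (rule AC_positive_off_cone[OF assms(1) AC_uminus[OF AC] e \<beta>, of a]) (use W in \<open>simp add: W_def\<close>)
    have "u x = - 1" for x using m[of x] by linarith
    then show ?thesis by blast
  qed
  then show False using assms(3) by (auto simp: constant_on_def)
qed

end
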